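(* For the constrained delegation problem, let $\psi_A$ be the decision scheme accepting all signals ($\psi_A(\sigma)=1$ for all $\sigma\in\Sigma$) and $\psi_R$ the decision scheme rejecting all signals ($\psi_R(\sigma)=0$ for all $\sigma\in\Sigma$). Then the better of $\psi_A$ and $\psi_R$ is a $2$-approximation to the optimal decision scheme $\psi^*$, i.e., $2\max\{U_r(\psi_A),U_r(\psi_R)\}\ge U_r(\psi^* )$.
   Context: Constrained delegation. An instance consists of a finite set $\Theta$ of states partitioned as $\Theta=\Theta_A\sqcup\Theta_R$ (acceptable and rejectable states), a finite set $\Sigma$ of signals, probabilities $q_\theta>0$ with $\sum_\theta q_\theta=1$, and a bipartite graph $H=(\Theta\cup\Sigma,E)$, $E\subseteq\Theta\times\Sigma$, without isolated vertices; $(\theta,\sigma)\in E$ means that $\sigma$ may be sent in state $\theta$, and $N(\theta)$ is the set of signals adjacent to $\theta$. The receiver commits to a decision scheme $\psi:\Sigma\to[0,1]$, where $\psi(\sigma)$ is the probability of accepting upon signal $\sigma$. In state $\theta$ the sender then sends a signal in $N(\theta)$ maximizing the acceptance probability. The receiver gets $1$ for accepting in a state of $\Theta_A$ or rejecting in a state of $\Theta_R$, and $0$ otherwise, so her utility is $$U_r(\psi)=\sum_{\theta\in\Theta_A}q_\theta\max_{\sigma\in N(\theta)}\psi(\sigma)+\sum_{\theta\in\Theta_R}q_\theta\Big(1-\max_{\sigma\in N(\theta)}\psi(\sigma)\Big).$$ An optimal decision scheme $\psi^*$ maximizes $U_r$. *)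

theory Defs
  imports Complex_Main
begin

locale constrained_delegation =
  fixes \<Theta> \<Theta>\<^sub>A \<Theta>\<^sub>R :: "'state set"
    and \<Sigma> :: "'signal set"
    and q :: "'state \<Rightarrow> real"
    and E :: "('state \<times> 'signal) set"
  assumes finite_states: "finite \<Theta>"
    and states_partition: "\<Theta> = \<Theta>\<^sub>A \<union> \<Theta>\<^sub>R" "\<Theta>\<^sub>A \<inter> \<Theta>\<^sub>R = {}"
    and finite_signals: "finite \<Sigma>"
    and prob_pos: "\<And>\<theta>. \<theta> \<in> \<Theta> \<Longrightarrow> q \<theta> > 0"
    and prob_sum: "(\<Sum>\<theta>\<in>\<Theta>. q \<theta>) = 1"
    and edges: "E \<subseteq> \<Theta> \<times> \<Sigma>"
    and no_isolated_state: "\<And>\<theta>. \<theta> \<in> \<Theta> \<Longrightarrow> \<exists>\<sigma>\<in>\<Sigma>. (\<theta>, \<sigma>) \<in> E"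
    and no_isolated_signal: "\<And>\<sigma>. \<sigma> \<in> \<Sigma> \<Longrightarrow> \<exists>\<theta>\<in>\<Theta>. (\<theta>, \<sigma>) \<in> E"

definition neighbours :: "('state \<times> 'signal) set \<Rightarrow> 'state \<Rightarrow> 'signal set" where
  "neighbours E \<theta> = {\<sigma>. (\<theta>, \<sigma>) \<in> E}"

text \<open>Decision schemes are maps on the signal set; values outside of it are unconstrained and
  play no role below.\<close>

definition decision_scheme :: "'signal set \<Rightarrow> ('signal \<Rightarrow> real) \<Rightarrow> bool" where
  "decision_scheme \<Sigma> \<psi> \<longleftrightarrow> (\<forall>\<sigma>\<in>\<Sigma>. 0 \<le> \<psi> \<sigma> \<and> \<psi> \<sigma> \<le> 1)"

text \<open>The sender best-responds, so in state \<open>\<theta>\<close> the receiver accepts with this probability. The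
  maximum is over a finite nonempty set for every state of an instance.\<close>

definition acceptance_prob ::
  "('state \<times> 'signal) set \<Rightarrow> ('signal \<Rightarrow> real) \<Rightarrow> 'state \<Rightarrow> real" where
  "acceptance_prob E \<psi> \<theta> = (MAX \<sigma>\<in>neighbours E \<theta>. \<psi> \<sigma>)"

definition receiver_utility ::
  "'state set \<Rightarrow> 'state set \<Rightarrow> ('state \<Rightarrow> real) \<Rightarrow> ('state \<times> 'signal) set
    \<Rightarrow> ('signal \<Rightarrow> real) \<Rightarrow> real" where
  "receiver_utility \<Theta>\<^sub>A \<Theta>\<^sub>R q E \<psi> =
     (\<Sum>\<theta>\<in>\<Theta>\<^sub>A. q \<theta> * acceptance_prob E \<psi> \<theta>)
   + (\<Sum>\<theta>\<in>\<Theta>\<^sub>R. q \<theta> * (1 - acceptance_prob E \<psi> \<theta>))"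

definition optimal_scheme ::
  "'state set \<Rightarrow> 'state set \<Rightarrow> 'signal set \<Rightarrow> ('state \<Rightarrow> real) \<Rightarrow> ('state \<times> 'signal) set
    \<Rightarrow> ('signal \<Rightarrow> real) \<Rightarrow> bool" where
  "optimal_scheme \<Theta>\<^sub>A \<Theta>\<^sub>R \<Sigma> q E \<psi> \<longleftrightarrow>
     is_arg_max (receiver_utility \<Theta>\<^sub>A \<Theta>\<^sub>R q E) (decision_scheme \<Sigma>) \<psi>"

definition accept_all :: "'signal \<Rightarrow> real" where
  "accept_all = (\<lambda>\<sigma>. 1)"

definition reject_all :: "'signal \<Rightarrow> real" where
  "reject_all = (\<lambda>\<sigma>. 0)"

end

theory Submission
  imports Defs
begin

text \<open>
  Accepting everything earns the total probability of the acceptable states and rejecting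
  everything that of the rejectable states. These two utilities add up to \<open>1\<close>, which bounds the
  utility of any decision scheme, so the larger one is at least half of the optimum.
\<close>

context constrained_delegation
begin

lemma finite_neighbours: "finite (neighbours E \<theta>)"
  by (rule finite_subset[OF _ finite_signals]) (use edges in \<open>auto simp: neighbours_def\<close>)

lemma neighbours_nonempty: "\<theta> \<in> \<Theta> \<Longrightarrow> neighbours E \<theta> \<noteq> {}"
  using no_isolated_state by (fastforce simp: neighbours_def)

text \<open>The neighbourhood is finite and nonempty, so the maximum is attained at some signal. By
  \<open>edges\<close> that signal lies in \<open>\<Sigma>\<close>, the only place where a decision
  scheme is known to take values between 0 and 1.\<close>

lemma acceptance_prob_bounds:
  assumes "decision_scheme \<Sigma> \<psi>" "\<theta> \<in> \<Theta>"
  shows "0 \<le> acceptance_prob E \<psi> \<theta>" "acceptance_prob E \<psi> \<theta> \<le> 1"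
proof -
  have "acceptance_prob E \<psi> \<theta> \<in> \<psi> ` neighbours E \<theta>"
    unfolding acceptance_prob_def
    using finite_neighbours neighbours_nonempty[OF assms(2)] by (intro Max_in) auto
  then obtain \<sigma> where "\<sigma> \<in> \<Sigma>" "acceptance_prob E \<psi> \<theta> = \<psi> \<sigma>"
    using edges by (auto simp: neighbours_def)
  then show "0 \<le> acceptance_prob E \<psi> \<theta>" "acceptance_prob E \<psi> \<theta> \<le> 1"
    using assms(1) by (auto simp: decision_scheme_def)
qed

text \<open>A constant map sends a nonempty neighbourhood to a singleton; for an empty one,
  \<open>Max\<close> would have no specified value.\<close>

lemma acceptance_prob_const: "\<theta> \<in> \<Theta> \<Longrightarrow> acceptance_prob E (\<lambda>\<sigma>. c) \<theta> = c"
  using neighbours_nonempty by (simp add: acceptance_prob_def image_constant_conv)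

lemma sum_partition: "sum q \<Theta>\<^sub>A + sum q \<Theta>\<^sub>R = 1"
  using prob_sum finite_states states_partition by (simp add: sum.union_disjoint)

lemma receiver_utility_accept_all: "receiver_utility \<Theta>\<^sub>A \<Theta>\<^sub>R q E accept_all = sum q \<Theta>\<^sub>A"
  by (simp add: receiver_utility_def accept_all_def acceptance_prob_const states_partition(1))

lemma receiver_utility_reject_all: "receiver_utility \<Theta>\<^sub>A \<Theta>\<^sub>R q E reject_all = sum q \<Theta>\<^sub>R"
  by (simp add: receiver_utility_def reject_all_def acceptance_prob_const states_partition(1))

lemma receiver_utility_le_1:
  assumes "decision_scheme \<Sigma> \<psi>"
  shows "receiver_utility \<Theta>\<^sub>A \<Theta>\<^sub>R q E \<psi> \<le> 1"
proof -
  \<comment> \<open>The bound holds state by state: each weight \<open>q \<theta>\<close> is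
    nonnegative and its factor is at most 1. For acceptable states this is the upper bound on the
    acceptance probability, for rejectable states the lower bound.\<close>
  have "receiver_utility \<Theta>\<^sub>A \<Theta>\<^sub>R q E \<psi> \<le> sum q \<Theta>\<^sub>A + sum q \<Theta>\<^sub>R"
    unfolding receiver_utility_def
    using acceptance_prob_bounds[OF assms] prob_pos states_partition(1)
    by (intro add_mono sum_mono mult_left_le) (auto intro: less_imp_le)
  then show ?thesis
    by (simp add: sum_partition)
qed

end

theorem proposition4p2:
  fixes \<Theta> \<Theta>\<^sub>A \<Theta>\<^sub>R :: "'state set"
    and \<Sigma> :: "'signal set"
    and q :: "'state \<Rightarrow> real"
    and E :: "('state \<times> 'signal) set"
    and \<psi>_opt :: "'signal \<Rightarrow> real"
  assumes "constrained_delegation \<Theta> \<Theta>\<^sub>A \<Theta>\<^sub>R \<Sigma> q E"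
    and "optimal_scheme \<Theta>\<^sub>A \<Theta>\<^sub>R \<Sigma> q E \<psi>_opt"
  shows "2 * max (receiver_utility \<Theta>\<^sub>A \<Theta>\<^sub>R q E accept_all)
                 (receiver_utility \<Theta>\<^sub>A \<Theta>\<^sub>R q E reject_all)
         \<ge> receiver_utility \<Theta>\<^sub>A \<Theta>\<^sub>R q E \<psi>_opt"
proof -
  interpret constrained_delegation \<Theta> \<Theta>\<^sub>A \<Theta>\<^sub>R \<Sigma> q E
    by (fact assms(1))
  \<comment> \<open>\<open>is_arg_max\<close> includes feasibility of the maximizer, so the bound
    for arbitrary schemes applies to it.\<close>
  have "decision_scheme \<Sigma> \<psi>_opt"
    using assms(2) by (simp add: optimal_scheme_def is_arg_max_def)
  then have "receiver_utility \<Theta>\<^sub>A \<Theta>\<^sub>R q E \<psi>_opt \<le> 1"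
    by (rule receiver_utility_le_1)
  then show ?thesis
    using sum_partition
    by (simp add: receiver_utility_accept_all receiver_utility_reject_all max_def)
qed

end
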